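(* Let $N\ge 1$, let $-1=x_0<x_1<\cdots<x_N=1$ be a grid, and let $\mathcal S=\{s_1,\ldots,s_N\}$ be a family of $N$ pairwise distinct intervals $s_i=[x_{\ell_i},x_{r_i}]$ with integers $0\le \ell_i<r_i\le N$. Let $A_{\mathcal S}\in\mathbb R^{N\times N}$ be the associated interval matrix and $\mathcal G_{\mathcal S}$ the associated endpoint graph. Then the following are equivalent: (1) $A_{\mathcal S}$ is nonsingular; (2) $\mathcal G_{\mathcal S}$ is connected. Consequently, $\det(A_{\mathcal S})\neq 0$ if and only if the intervals of $\mathcal S$ connect all grid points (i.e. any two vertices of $\mathcal G_{\mathcal S}$ are joined by a path).
   Context: The interval matrix $A_{\mathcal S}\in\mathbb R^{N\times N}$ is defined by $[A_{\mathcal S}]_{ij}=1$ if $\ell_i<j\le r_i$ and $[A_{\mathcal S}]_{ij}=0$ otherwise, $i,j=1,\ldots,N$ (so the entry is $1$ exactly when the elementary cell $[x_{j-1},x_j]$ is contained in $s_i$). The endpoint graph $\mathcal G_{\mathcal S}=(\mathcal V_N,\mathcal E_{\mathcal S})$ is the undirected graph with vertex set $\mathcal V_N=\{0,1,\ldots,N\}$ and edge set $\mathcal E_{\mathcal S}=\{\{\ell_i,r_i\}: i=1,\ldots,N\}$. *)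

theory Defs
  imports
    Complex_Main
    "Jordan_Normal_Form.Determinant"
    "Graph_Theory.Graph_Theory"
begin

text \<open>
  A family of intervals \<open>s\<^sub>i = [x\<^bsub>l i\<^esub>, x\<^bsub>r i\<^esub>]\<close>, \<open>i = 1, \<dots>, N\<close>, is given by its endpoint
  indices \<open>l\<close> and \<open>r\<close>. Library matrices are indexed from 0, so position \<open>(i, j)\<close> below holds
  the mathematical entry with indices \<open>i + 1\<close> and \<open>j + 1\<close>.
\<close>

definition interval_matrix :: "nat \<Rightarrow> (nat \<Rightarrow> nat) \<Rightarrow> (nat \<Rightarrow> nat) \<Rightarrow> real mat" where
  "interval_matrix N l r =
     mat N N (\<lambda>(i, j). if l (i + 1) < j + 1 \<and> j + 1 \<le> r (i + 1) then 1 else 0)"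

lemma interval_matrix_cell_subset:
  fixes x :: "nat \<Rightarrow> real"
  assumes "strict_mono_on {0..N} x"
    and "\<And>i. i \<in> {1..N} \<Longrightarrow> l i < r i \<and> r i \<le> N"
    and "i \<in> {1..N}" and "j \<in> {1..N}"
  shows "interval_matrix N l r $$ (i - 1, j - 1) =
    (if {x (j - 1)..x j} \<subseteq> {x (l i)..x (r i)} then 1 else 0)"
proof -
  have lr: "l i < r i" "r i \<le> N" using assms by auto
  have le: "x a \<le> x b \<longleftrightarrow> a \<le> b" if "a \<le> N" "b \<le> N" for a b
    using strict_mono_on_less_eq[OF assms(1), of a b] that by auto
  have "x (j - 1) \<le> x j" "x (l i) \<le> x (j - 1) \<longleftrightarrow> l i \<le> j - 1" "x j \<le> x (r i) \<longleftrightarrow> j \<le> r i"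
    using lr assms(4) by (auto intro!: le[THEN iffD2] le)
  then show ?thesis using assms(3,4) by (auto simp: interval_matrix_def)
qed

definition endpoint_edges :: "nat \<Rightarrow> (nat \<Rightarrow> nat) \<Rightarrow> (nat \<Rightarrow> nat) \<Rightarrow> nat set set" where
  "endpoint_edges N l r = {{l i, r i} | i. i \<in> {1..N}}"

text \<open>
  An undirected graph is represented, as usual in the graph library, by a symmetric digraph:
  every edge \<open>{u, v}\<close> gives rise to the two arcs \<open>(u, v)\<close> and \<open>(v, u)\<close>.
\<close>

definition endpoint_graph :: "nat \<Rightarrow> (nat \<Rightarrow> nat) \<Rightarrow> (nat \<Rightarrow> nat) \<Rightarrow> nat pair_pre_digraph" where
  "endpoint_graph N l r =
     \<lparr> pverts = {0..N}, parcs = {(u, v). {u, v} \<in> endpoint_edges N l r} \<rparr>"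

lemma pair_graph_endpoint_graph:
  assumes "\<And>i. i \<in> {1..N} \<Longrightarrow> l i < r i \<and> r i \<le> N"
  shows "pair_graph (endpoint_graph N l r)"
proof -
  have arc: "u \<le> N \<and> v \<le> N \<and> u \<noteq> v" if "(u, v) \<in> parcs (endpoint_graph N l r)" for u v
    using that assms by (fastforce simp: endpoint_graph_def endpoint_edges_def doubleton_eq_iff)
  have "parcs (endpoint_graph N l r) \<subseteq> {0..N} \<times> {0..N}" using arc by auto
  then have fin: "finite (parcs (endpoint_graph N l r))" by (rule finite_subset) simp
  show ?thesis
  proof
    show "finite (pverts (endpoint_graph N l r))" by (simp add: endpoint_graph_def)
    show "finite (parcs (endpoint_graph N l r))" by (rule fin)
    show "symmetric (with_proj (endpoint_graph N l r))"
      by (auto simp: symmetric_def sym_def arcs_ends_def arc_to_ends_def endpoint_graph_def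
          insert_commute)
  qed (use arc in \<open>fastforce simp: endpoint_graph_def\<close>)+
qed

end

theory Submission
  imports Defs
begin

text \<open>
  The columns of the matrix correspond to the cells \<open>[x\<^bsub>j - 1\<^esub>, x\<^sub>j]\<close>. A vector indexed by the
  cells is the same thing as the increments of a function \<open>h\<close> on the grid points
  (a potential), unique up to an additive constant. The entry of the matrix-vector product that
  belongs to an interval is the sum of the increments over the cells of that interval, and this
  telescopes to \<open>h (r i) - h (l i)\<close>. Hence the kernel of the interval matrix consists of the
  increments of those potentials that take equal values at the two ends of every edge of the
  endpoint graph, that is, of the potentials that are constant on each connected component. The
  zero vector corresponds to the constant potentials. So the kernel is trivial exactly when a
  potential that is constant on components is constant altogether, and this is connectedness:
  otherwise the indicator of the vertices reachable from 0 is a nonconstant potential of this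
  kind.

  The telescoping is lemma \<open>interval_matrix_mult_increments\<close>, the description of the kernel is
  behind \<open>det_interval_matrix_nonzero_iff\<close>, and the graph side is
  \<open>all_reachable_iff_potentials_constant\<close>.
\<close>

lemma invertible_mat_iff_det_nonzero:
  fixes A :: "'a :: field mat"
  assumes A: "A \<in> carrier_mat n n"
  shows "invertible_mat A \<longleftrightarrow> Determinant.det A \<noteq> 0"
proof
  assume "invertible_mat A"
  then obtain B where AB: "A * B = 1\<^sub>m n" and BA: "B * A = 1\<^sub>m (dim_row B)"
    using A by (auto simp: invertible_mat_def inverts_mat_def)
  have "dim_col B = n" using arg_cong[OF AB, of dim_col] by simp
  moreover have "dim_row B = n" using arg_cong[OF BA, of dim_col] A by simp
  ultimately have "B \<in> carrier_mat n n" by auto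
  from det_mult[OF A this] AB show "Determinant.det A \<noteq> 0" by auto
next
  assume "Determinant.det A \<noteq> 0"
  from det_non_zero_imp_unit[OF A this, of undefined] obtain B
    where "B \<in> carrier_mat n n" "A * B = 1\<^sub>m n" "B * A = 1\<^sub>m n"
    by (auto simp: Units_def ring_mat_def)
  then show "invertible_mat A"
    using A by (auto simp: invertible_mat_def inverts_mat_def)
qed

definition increments :: "nat \<Rightarrow> (nat \<Rightarrow> real) \<Rightarrow> real vec" where
  "increments N h = vec N (\<lambda>j. h (Suc j) - h j)"

lemma increments_carrier [simp]: "increments N h \<in> carrier_vec N"
  by (simp add: increments_def)

text \<open>
  Every vector comes from a potential, so statements about all vectors can be proved for increments
  only.
\<close>

lemma vec_eq_increments:
  assumes "v \<in> carrier_vec N"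
  shows "v = increments N (\<lambda>k. \<Sum>j<k. v $ j)"
  using assms by (auto simp: increments_def)

lemma increments_eq_zero_iff: "increments N h = 0\<^sub>v N \<longleftrightarrow> (\<forall>k\<le>N. h k = h 0)"
proof
  assume "increments N h = 0\<^sub>v N"
  then have step: "h (Suc j) = h j" if "j < N" for j
    using that by (auto simp: increments_def vec_eq_iff)
  have "h k = h 0" if "k \<le> N" for k
    using that by (induction k) (auto simp: step)
  then show "\<forall>k\<le>N. h k = h 0" by blast
next
  assume "\<forall>k\<le>N. h k = h 0"
  then have "h (Suc j) - h j = 0" if "j < N" for j
    using that by (metis Suc_leI less_imp_le diff_self)
  then show "increments N h = 0\<^sub>v N"
    by (auto simp: increments_def vec_eq_iff)
qed

text \<open>
  A row of the matrix selects the consecutive cells of its interval, so the increments over these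
  cells telescope. The index shift reconciles matrix rows, counted from 0, with intervals, counted
  from 1.
\<close>

lemma interval_matrix_mult_increments:
  assumes "i < N" and "l (Suc i) < r (Suc i)" and "r (Suc i) \<le> N"
  shows "(interval_matrix N l r *\<^sub>v increments N h) $ i = h (r (Suc i)) - h (l (Suc i))"
proof -
  have "(interval_matrix N l r *\<^sub>v increments N h) $ i
      = (\<Sum>j\<in>{0..<N}. (if l (Suc i) \<le> j \<and> j < r (Suc i) then 1 else 0) * (h (Suc j) - h j))"
    using \<open>i < N\<close>
    by (auto simp: interval_matrix_def increments_def scalar_prod_def less_Suc_eq_le Suc_le_eq
        intro!: sum.cong)
  also have "\<dots> = (\<Sum>j\<in>{l (Suc i)..<r (Suc i)}. h (Suc j) - h j)"
    using assms by (intro sum.mono_neutral_cong_right) auto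
  also have "\<dots> = h (r (Suc i)) - h (l (Suc i))"
    using assms by (intro sum_Suc_diff') auto
  finally show ?thesis .
qed

text \<open>
  A square matrix is singular iff it kills a nonzero vector. Every vector is the increment vector
  of a potential, so the test can be carried out on potentials, where lying in the kernel means
  agreeing at the two endpoints of each interval and being zero means being constant.
\<close>

lemma det_interval_matrix_nonzero_iff:
  assumes lr: "\<And>i. i \<in> {1..N} \<Longrightarrow> l i < r i \<and> r i \<le> N"
  shows "Determinant.det (interval_matrix N l r) \<noteq> 0 \<longleftrightarrow>
    (\<forall>h :: nat \<Rightarrow> real. (\<forall>i\<in>{1..N}. h (l i) = h (r i)) \<longrightarrow> (\<forall>k\<le>N. h k = h 0))"
proof -
  let ?A = "interval_matrix N l r"
  have A: "?A \<in> carrier_mat N N" by (simp add: interval_matrix_def)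
  have ker: "?A *\<^sub>v increments N h = 0\<^sub>v N \<longleftrightarrow> (\<forall>i\<in>{1..N}. h (l i) = h (r i))" for h
  proof -
    have "?A *\<^sub>v increments N h = 0\<^sub>v N \<longleftrightarrow> (\<forall>i<N. (?A *\<^sub>v increments N h) $ i = 0)"
      using A by (auto simp: vec_eq_iff)
    also have "\<dots> \<longleftrightarrow> (\<forall>i<N. h (l (Suc i)) = h (r (Suc i)))"
      using lr by (auto simp: interval_matrix_mult_increments)
    also have "\<dots> \<longleftrightarrow> (\<forall>i\<in>Suc ` {..<N}. h (l i) = h (r i))" by auto
    also have "Suc ` {..<N} = {1..N}" by (simp add: lessThan_atLeast0 image_Suc_atLeastLessThan
          atLeastLessThanSuc_atLeastAtMost)
    finally show ?thesis .
  qed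
  have "Determinant.det ?A \<noteq> 0 \<longleftrightarrow> (\<forall>v\<in>carrier_vec N. ?A *\<^sub>v v = 0\<^sub>v N \<longrightarrow> v = 0\<^sub>v N)"
    using det_0_iff_vec_prod_zero[OF A] by blast
  also have "\<dots> \<longleftrightarrow> (\<forall>h. ?A *\<^sub>v increments N h = 0\<^sub>v N \<longrightarrow> increments N h = 0\<^sub>v N)"
  proof (intro iffI ballI allI)
    fix v :: "real vec"
    assume *: "\<forall>h. ?A *\<^sub>v increments N h = 0\<^sub>v N \<longrightarrow> increments N h = 0\<^sub>v N" and "v \<in> carrier_vec N"
    then obtain h where "v = increments N h" using vec_eq_increments by blast
    with * show "?A *\<^sub>v v = 0\<^sub>v N \<longrightarrow> v = 0\<^sub>v N" by simp
  qed simp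
  finally show ?thesis by (simp only: ker increments_eq_zero_iff)
qed

lemma endpoint_graph_arc_iff:
  "(u, v) \<in> parcs (endpoint_graph N l r) \<longleftrightarrow>
    (\<exists>i\<in>{1..N}. (u = l i \<and> v = r i) \<or> (u = r i \<and> v = l i))"
  by (auto simp: endpoint_graph_def endpoint_edges_def doubleton_eq_iff)

text \<open>
  A potential with equal values at the ends of every edge is constant along walks; conversely the
  indicator of the set reachable from 0 is such a potential, because an edge never leaves that
  set in either direction.
\<close>

lemma all_reachable_iff_potentials_constant:
  fixes N :: nat and l r :: "nat \<Rightarrow> nat"
  defines "G \<equiv> with_proj (endpoint_graph N l r)"
  assumes lr: "\<And>i. i \<in> {1..N} \<Longrightarrow> l i < r i \<and> r i \<le> N"
  shows "(\<forall>u\<in>{0..N}. \<forall>v\<in>{0..N}. u \<rightarrow>\<^sup>*\<^bsub>G\<^esub> v) \<longleftrightarrow>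
    (\<forall>h :: nat \<Rightarrow> real. (\<forall>i\<in>{1..N}. h (l i) = h (r i)) \<longrightarrow> (\<forall>k\<le>N. h k = h 0))"
    (is "?reach \<longleftrightarrow> ?const")
proof -
  interpret pair_graph "endpoint_graph N l r" using lr by (rule pair_graph_endpoint_graph)
  have arc: "l i \<rightarrow>\<^bsub>G\<^esub> r i" "r i \<rightarrow>\<^bsub>G\<^esub> l i" if "i \<in> {1..N}" for i
    using that by (auto simp: G_def endpoint_graph_arc_iff)
  have verts: "u \<rightarrow>\<^sup>*\<^bsub>G\<^esub> u" if "u \<le> N" for u
    using that by (simp add: G_def endpoint_graph_def reachable_def)
  show ?thesis
  proof
    assume reach: ?reach
    show ?const
    proof (intro allI impI)
      fix h :: "nat \<Rightarrow> real" and k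
      assume h: "\<forall>i\<in>{1..N}. h (l i) = h (r i)" and "k \<le> N"
      from reach \<open>k \<le> N\<close> have "0 \<rightarrow>\<^sup>*\<^bsub>G\<^esub> k" by simp
      then show "h k = h 0"
        unfolding G_def
      proof (induction rule: reachable_induct)
        case (step u v)
        then show ?case using h by (auto simp: endpoint_graph_arc_iff)
      qed simp
    qed
  next
    assume const: ?const
    define h :: "nat \<Rightarrow> real" where "h k = (if 0 \<rightarrow>\<^sup>*\<^bsub>G\<^esub> k then 1 else 0)" for k
    have "h (l i) = h (r i)" if "i \<in> {1..N}" for i
      using reachable_adj_trans[folded G_def] arc[OF that] unfolding h_def G_def by force
    with const have "\<forall>k\<le>N. h k = h 0" by blast
    then have from0: "0 \<rightarrow>\<^sup>*\<^bsub>G\<^esub> k" if "k \<le> N" for k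
      using verts[of 0] that by (auto simp: h_def split: if_splits)
    have "k \<rightarrow>\<^sup>*\<^bsub>G\<^esub> 0" if "k \<le> N" for k
      unfolding G_def by (rule symmetric_reachable[OF pair_sym_arcs from0[OF that, unfolded G_def]])
    then show ?reach
      using from0 reachable_trans[folded G_def] by (meson atLeastAtMost_iff)
  qed
qed

theorem theorem1:
  fixes N :: nat and x :: "nat \<Rightarrow> real" and l r :: "nat \<Rightarrow> nat"
  assumes "N \<ge> 1"
    and "x 0 = -1" and "x N = 1" and "strict_mono_on {0..N} x"
    and "\<And>i. i \<in> {1..N} \<Longrightarrow> l i < r i \<and> r i \<le> N"
    and "inj_on (\<lambda>i. {x (l i)..x (r i)}) {1..N}"
  shows "(invertible_mat (interval_matrix N l r) \<longleftrightarrow>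
        Digraph_Component.connected (with_proj (endpoint_graph N l r)))
    \<and> (Determinant.det (interval_matrix N l r) \<noteq> 0 \<longleftrightarrow>
        (\<forall>u \<in> {0..N}. \<forall>v \<in> {0..N}. \<exists>p. pre_digraph.apath (with_proj (endpoint_graph N l r)) u p v))"
proof -
  let ?A = "interval_matrix N l r" and ?G = "with_proj (endpoint_graph N l r)"
  interpret pair_graph "endpoint_graph N l r" using assms(5) by (rule pair_graph_endpoint_graph)
  have det: "Determinant.det ?A \<noteq> 0 \<longleftrightarrow> (\<forall>u\<in>{0..N}. \<forall>v\<in>{0..N}. u \<rightarrow>\<^sup>*\<^bsub>?G\<^esub> v)"
    using det_interval_matrix_nonzero_iff[of N l r] all_reachable_iff_potentials_constant[of N l r]
      assms(5) by blast
  have inv: "invertible_mat ?A \<longleftrightarrow> Determinant.det ?A \<noteq> 0"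
    by (rule invertible_mat_iff_det_nonzero[of _ N]) (simp add: interval_matrix_def)
  \<comment> \<open>Connectedness is defined through the symmetrized graph, but every edge is already present as
     a pair of opposite arcs, so symmetrizing does not change reachability.\<close>
  have "Digraph_Component.connected ?G \<longleftrightarrow> (\<forall>u\<in>{0..N}. \<forall>v\<in>{0..N}. u \<rightarrow>\<^sup>*\<^bsub>?G\<^esub> v)"
    using reachable_mk_symmetric_eq[OF pair_sym_arcs]
    by (simp add: Digraph_Component.connected_def strongly_connected_def endpoint_graph_def)
  with det inv show ?thesis by (simp add: reachable_apath)
qed

end
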